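(* Let $T=\{(z,0): z\in\mathbb{D}\}\cup\{(0,z): z\in\mathbb{D}\}\subset\mathbb{C}^2$, where $\mathbb{D}$ is the open unit disc, and let $G$ be a balanced domain of holomorphy in $\mathbb{C}^2$ with $T\subseteq G$. Then $(G,T)$ is norm preserving if and only if $G\subseteq\{\lambda\in\mathbb{C}^2 : |\lambda_1|+|\lambda_2|<1\}$.
   Context: A set $G\subseteq\mathbb{C}^2$ is balanced if $\zeta\lambda\in G$ whenever $\lambda\in G$, $\zeta\in\mathbb{C}$, $|\zeta|\le1$. Domains of holomorphy are connected. If $\Omega$ is a domain of holomorphy in $\mathbb{C}^n$, an analytic set in $\Omega$ is a relatively closed set $V$ in $\Omega$ which near each of its points is the common zero set of finitely many holomorphic functions. A function $f:V\to\mathbb{C}$ is holomorphic on $V$ if each $\lambda\in V$ has an open neighborhood $U$ in $\mathbb{C}^n$ and a holomorphic function $F$ on $U$ with $F=f$ on $V\cap U$. A Cartan pair $(\Omega,V)$ consists of a domain of holomorphy $\Omega$ and an analytic set $V$ in $\Omega$. The pair $(\Omega,V)$ is norm preserving (an np pair) if it is a Cartan pair and for every bounded holomorphic $f$ on $V$ there is a holomorphic $F$ on $\Omega$ with $F|_V=f$ and $\sup_{\Omega}|F|=\sup_V|f|$. *)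

theory Defs
  imports "HOL-Analysis.Analysis"
begin

(* Holomorphy in several variables: the real Frechet derivative exists at each
   point and is complex-linear.  Only used for open U. *)
definition holomorphic_several_on ::
    "(complex ^ 'n \<Rightarrow> complex) \<Rightarrow> (complex ^ 'n) set \<Rightarrow> bool" where
  "holomorphic_several_on F U \<longleftrightarrow>
     (\<forall>x\<in>U. \<exists>D. (F has_derivative D) (at x) \<and> (\<forall>c v. D (c *s v) = c * D v))"

definition balanced :: "(complex ^ 'n) set \<Rightarrow> bool" where
  "balanced G \<longleftrightarrow> (\<forall>x\<in>G. \<forall>\<zeta>. cmod \<zeta> \<le> 1 \<longrightarrow> \<zeta> *s x \<in> G)"

(* The standard (Hoermander) definition: there is no connected open set W, not
   contained in \<Omega>, to which every holomorphic function on \<Omega> extends, where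
   "extends" means agreement on a fixed nonempty open subset U of \<Omega> \<inter> W. *)
definition domain_of_holomorphy :: "(complex ^ 'n) set \<Rightarrow> bool" where
  "domain_of_holomorphy \<Omega> \<longleftrightarrow>
     open \<Omega> \<and> connected \<Omega> \<and> \<Omega> \<noteq> {} \<and>
     \<not> (\<exists>U W. open U \<and> open W \<and> U \<noteq> {} \<and> U \<subseteq> \<Omega> \<inter> W \<and> connected W \<and> \<not> W \<subseteq> \<Omega> \<and>
           (\<forall>f. holomorphic_several_on f \<Omega> \<longrightarrow>
              (\<exists>g. holomorphic_several_on g W \<and> (\<forall>x\<in>U. g x = f x))))"

definition analytic_set_in :: "(complex ^ 'n) set \<Rightarrow> (complex ^ 'n) set \<Rightarrow> bool" where
  "analytic_set_in V \<Omega> \<longleftrightarrow>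
     closedin (top_of_set \<Omega>) V \<and>
     (\<forall>p\<in>V. \<exists>U H. open U \<and> p \<in> U \<and> U \<subseteq> \<Omega> \<and> finite H \<and>
        (\<forall>h\<in>H. holomorphic_several_on h U) \<and>
        V \<inter> U = {x\<in>U. \<forall>h\<in>H. h x = 0})"

definition holomorphic_on_subset ::
    "(complex ^ 'n \<Rightarrow> complex) \<Rightarrow> (complex ^ 'n) set \<Rightarrow> bool" where
  "holomorphic_on_subset f V \<longleftrightarrow>
     (\<forall>p\<in>V. \<exists>U F. open U \<and> p \<in> U \<and> holomorphic_several_on F U \<and> (\<forall>x\<in>V \<inter> U. F x = f x))"

definition Cartan_pair :: "(complex ^ 'n) set \<Rightarrow> (complex ^ 'n) set \<Rightarrow> bool" where
  "Cartan_pair \<Omega> V \<longleftrightarrow> domain_of_holomorphy \<Omega> \<and> analytic_set_in V \<Omega>"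

(* The suprema are taken in ennreal, so that sup |F| is infinite for an unbounded F
   (and the supremum over the empty set is 0). *)
definition np_pair :: "(complex ^ 'n) set \<Rightarrow> (complex ^ 'n) set \<Rightarrow> bool" where
  "np_pair \<Omega> V \<longleftrightarrow> Cartan_pair \<Omega> V \<and>
     (\<forall>f. holomorphic_on_subset f V \<and> bounded (f ` V) \<longrightarrow>
        (\<exists>F. holomorphic_several_on F \<Omega> \<and> (\<forall>x\<in>V. F x = f x) \<and>
             (SUP x\<in>\<Omega>. ennreal (cmod (F x))) = (SUP x\<in>V. ennreal (cmod (f x)))))"

definition crossed_discs :: "(complex ^ 2) set" where
  "crossed_discs = {vector [z, 0] | z. cmod z < 1} \<union> {vector [0, z] | z. cmod z < 1}"

end

theory Submission
  imports Defs "HOL-Complex_Analysis.Riemann_Mapping"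
begin

text \<open>Write T for the crossed discs and Delta for the set where |x1| + |x2| < 1. If G lies in
  Delta, then T is the zero set of x1 x2 in G, and a bounded holomorphic f on T with supremum M
  amounts to two functions g, h on the unit disc with g(0) = h(0). If |g(0)| = M, the maximum
  principle makes both constant. Otherwise scale to M = 1 and let phi be the disc automorphism
  taking the common value to 0. By the Schwarz lemma phi(g(x1)) + phi(h(x2)) has modulus below 1 on
  Delta, and applying the inverse of phi gives an extension with the same bound
  (\<open>diamond_extension\<close>, \<open>np_pair_crossed_discs\<close>). Conversely, let (G,T) be
  norm preserving and p in G. For |c| = 1 the linear form x1 + c x2 is bounded by 1 on T, so it has
  an extension F to G bounded by 1. The two axes span the plane, so the differential of F at 0 is
  the form itself. As G is balanced, it contains the closed disc through p, and the Cauchy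
  inequality there gives |p1 + c p2| <= 1; a suitable c yields |p1| + |p2| <= 1
  (\<open>np_pair_crossed_discs_norm_le\<close>). Since G is open, the inequality is strict.\<close>

section \<open>Holomorphy in several variables: complex lines and closure properties\<close>

lemma has_field_derivative_slice:
  fixes F :: "complex ^ 'n \<Rightarrow> complex"
  assumes "(F has_derivative D) (at (z *s v))" and "\<And>c v. D (c *s v) = c * D v"
  shows "((\<lambda>z. F (z *s v)) has_field_derivative D v) (at z)"
proof -
  have "linear (\<lambda>z::complex. z *s v)"
    by (rule linearI) (simp_all add: vec_eq_iff algebra_simps)
  then have "((\<lambda>z::complex. z *s v) has_derivative (\<lambda>z. z *s v)) (at z)"
    by (intro bounded_linear_imp_has_derivative) (simp add: linear_conv_bounded_linear)
  from has_derivative_compose[OF this assms(1)] show ?thesis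
    by (simp add: has_field_derivative_def assms(2) mult.commute[of _ "D v"])
qed

lemma holomorphic_several_on_subset:
  "holomorphic_several_on F U \<Longrightarrow> V \<subseteq> U \<Longrightarrow> holomorphic_several_on F V"
  by (auto simp: holomorphic_several_on_def)

lemma holomorphic_several_on_nth:
  "holomorphic_several_on (\<lambda>x::complex^'n. x $ i) U"
  unfolding holomorphic_several_on_def
  by (intro ballI exI[of _ "\<lambda>x. x $ i"])
    (auto intro: bounded_linear_imp_has_derivative bounded_linear_vec_nth)

lemma holomorphic_several_on_const:
  "holomorphic_several_on (\<lambda>x::complex^'n. c) U"
  unfolding holomorphic_several_on_def
  by (intro ballI exI[of _ "\<lambda>x. 0"]) auto

lemma holomorphic_several_on_add:
  assumes "holomorphic_several_on F U" "holomorphic_several_on H U"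
  shows "holomorphic_several_on (\<lambda>x. F x + H x) U"
  unfolding holomorphic_several_on_def
proof
  fix x assume "x \<in> U"
  with assms obtain D E where
    "(F has_derivative D) (at x)" "\<forall>c v. D (c *s v) = c * D v"
    "(H has_derivative E) (at x)" "\<forall>c v. E (c *s v) = c * E v"
    unfolding holomorphic_several_on_def by metis
  then show "\<exists>D. ((\<lambda>x. F x + H x) has_derivative D) (at x) \<and> (\<forall>c v. D (c *s v) = c * D v)"
    by (intro exI[of _ "\<lambda>v. D v + E v"])
      (auto intro: has_derivative_add simp: algebra_simps)
qed

lemma holomorphic_several_on_mult:
  assumes "holomorphic_several_on F U" "holomorphic_several_on H U"
  shows "holomorphic_several_on (\<lambda>x. F x * H x) U"
  unfolding holomorphic_several_on_def
proof
  fix x assume "x \<in> U"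
  with assms obtain D E where
    "(F has_derivative D) (at x)" "\<forall>c v. D (c *s v) = c * D v"
    "(H has_derivative E) (at x)" "\<forall>c v. E (c *s v) = c * E v"
    unfolding holomorphic_several_on_def by metis
  then have "((\<lambda>x. F x * H x) has_derivative (\<lambda>v. F x * E v + D v * H x)) (at x)"
    and "\<forall>c v. F x * E (c *s v) + D (c *s v) * H x = c * (F x * E v + D v * H x)"
    by (blast intro: has_derivative_mult) (simp add: \<open>\<forall>c v. D (c *s v) = c * D v\<close> \<open>\<forall>c v. E (c *s v) = c * E v\<close> algebra_simps)
  then show "\<exists>D. ((\<lambda>x. F x * H x) has_derivative D) (at x) \<and> (\<forall>c v. D (c *s v) = c * D v)"
    by blast
qed

lemma holomorphic_several_on_compose:
  assumes "holomorphic_several_on F U" "\<phi> holomorphic_on S" "open S" "F ` U \<subseteq> S"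
  shows "holomorphic_several_on (\<lambda>x. \<phi> (F x)) U"
  unfolding holomorphic_several_on_def
proof
  fix x assume x: "x \<in> U"
  with assms(1) obtain D where
    D: "(F has_derivative D) (at x)" "\<forall>c v. D (c *s v) = c * D v"
    unfolding holomorphic_several_on_def by metis
  have "(\<phi> has_field_derivative deriv \<phi> (F x)) (at (F x))"
    using assms(2-4) x by (auto intro: holomorphic_derivI)
  then have "(\<phi> has_derivative (*) (deriv \<phi> (F x))) (at (F x))"
    by (simp add: has_field_derivative_def)
  from has_derivative_compose[OF D(1) this]
  show "\<exists>D. ((\<lambda>x. \<phi> (F x)) has_derivative D) (at x) \<and> (\<forall>c v. D (c *s v) = c * D v)"
    using D(2) by (intro exI[of _ "\<lambda>v. deriv \<phi> (F x) * D v"]) auto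
qed

text \<open>Near each point \<open>f\<close> agrees on \<open>V\<close> with an ambient holomorphic
  \<open>F\<close>, and the line stays in \<open>V\<close>, so the slice of \<open>f\<close>
  inherits the derivative of the slice of \<open>F\<close>. With \<open>v\<close> a coordinate
  vector this turns a function on the crossed discs into two functions on the unit disc.\<close>

lemma holomorphic_on_subset_slice:
  fixes v :: "complex^'n"
  assumes "holomorphic_on_subset f V" "open S" "\<And>z. z \<in> S \<Longrightarrow> z *s v \<in> V"
  shows "(\<lambda>z. f (z *s v)) holomorphic_on S"
  unfolding holomorphic_on_open[OF assms(2)]
proof
  fix z assume z: "z \<in> S"
  then obtain U F where U: "open U" "z *s v \<in> U" "holomorphic_several_on F U"
      and F: "\<And>x. x \<in> V \<inter> U \<Longrightarrow> F x = f x"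
    using assms(1,3) unfolding holomorphic_on_subset_def by metis
  from U obtain D where "(F has_derivative D) (at (z *s v))" "\<And>c v. D (c *s v) = c * D v"
    unfolding holomorphic_several_on_def by metis
  then have der: "((\<lambda>z. F (z *s v)) has_field_derivative D v) (at z)"
    by (rule has_field_derivative_slice)
  have "continuous_on UNIV (\<lambda>z::complex. z *s v)"
    unfolding vector_scalar_mult_def by (intro continuous_intros)
  then have "open ((\<lambda>z. z *s v) -` U)"
    using U(1) by (simp add: continuous_on_open_vimage)
  then have "open (S \<inter> (\<lambda>z. z *s v) -` U)"
    using assms(2) by blast
  then have "((\<lambda>z. f (z *s v)) has_field_derivative D v) (at z)"
    by (rule has_field_derivative_transform_within_open[OF der]) (use z U(2) assms(3) F in auto)
  then show "\<exists>f'. ((\<lambda>z. f (z *s v)) has_field_derivative f') (at z)" ..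
qed

section \<open>The crossed discs in coordinates\<close>

lemma crossed_discs_eq:
  "crossed_discs = (\<lambda>z. z *s vector [1, 0]) ` ball 0 1 \<union> (\<lambda>z. z *s vector [0, 1]) ` ball 0 1"
proof -
  have "z *s (vector [1, 0] :: complex^2) = vector [z, 0]"
    "z *s (vector [0, 1] :: complex^2) = vector [0, z]" for z
    by (simp_all add: vec_eq_iff forall_2)
  then show ?thesis
    by (auto simp: crossed_discs_def)
qed

lemma axis_in_crossed_discs:
  assumes "cmod z < 1"
  shows "z *s vector [1, 0] \<in> crossed_discs" and "z *s vector [0, 1] \<in> crossed_discs"
  using assms by (auto simp: crossed_discs_eq)

text \<open>When one coordinate vanishes, the sum of the moduli is the modulus of the other. This
  exhibits the crossed discs as the zero set of a single polynomial in the diamond.\<close>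

lemma crossed_discs_eq_diamond:
  "crossed_discs = {x. cmod (x $ 1) + cmod (x $ 2) < 1} \<inter> {x. x $ 1 * x $ 2 = 0}"
proof -
  have "x = vector [x $ 1, x $ 2]" for x :: "complex^2"
    by (simp add: vec_eq_iff forall_2)
  then have "x \<in> crossed_discs" if "cmod (x $ 1) + cmod (x $ 2) < 1" "x $ 1 * x $ 2 = 0" for x
    using that unfolding crossed_discs_def
    by (smt (verit, best) UnCI mem_Collect_eq mult_eq_0_iff norm_ge_zero)
  then show ?thesis
    by (auto simp: crossed_discs_def)
qed

section \<open>Extension from the crossed discs to the diamond\<close>

text \<open>The Schwarz lemma bounds the two summands by |x1| and |x2|, whose sum is below 1 on the
  diamond. As \<open>g\<close> and \<open>h\<close> vanish at 0, on each axis the sum reduces to one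
  of them, so it is an extension.\<close>

lemma diamond_extension_of_centred:
  fixes g h :: "complex \<Rightarrow> complex"
  assumes "g holomorphic_on ball 0 1" "h holomorphic_on ball 0 1" "g 0 = 0" "h 0 = 0"
    and "\<And>z. cmod z < 1 \<Longrightarrow> cmod (g z) < 1" "\<And>z. cmod z < 1 \<Longrightarrow> cmod (h z) < 1"
  defines "\<Delta> \<equiv> {x::complex^2. cmod (x $ 1) + cmod (x $ 2) < 1}"
  shows "holomorphic_several_on (\<lambda>x. g (x $ 1) + h (x $ 2)) \<Delta>"
    and "x \<in> \<Delta> \<Longrightarrow> cmod (g (x $ 1) + h (x $ 2)) < 1"
proof -
  have coord: "cmod (x $ 1) < 1" "cmod (x $ 2) < 1" if "x \<in> \<Delta>" for x
    using that norm_ge_zero[of "x $ 1"] norm_ge_zero[of "x $ 2"] unfolding \<Delta>_def mem_Collect_eq by linarith+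
  then show "holomorphic_several_on (\<lambda>x. g (x $ 1) + h (x $ 2)) \<Delta>"
    by (intro holomorphic_several_on_add
        holomorphic_several_on_compose[OF holomorphic_several_on_nth assms(1) open_ball]
        holomorphic_several_on_compose[OF holomorphic_several_on_nth assms(2) open_ball]) auto
  assume x: "x \<in> \<Delta>"
  have "cmod (g (x $ 1)) \<le> cmod (x $ 1)" "cmod (h (x $ 2)) \<le> cmod (x $ 2)"
    using coord[OF x]
    by (auto intro: Schwarz_Lemma(1)[OF assms(1,3,5)] Schwarz_Lemma(1)[OF assms(2,4,6)])
  then show "cmod (g (x $ 1) + h (x $ 2)) < 1"
    using x norm_triangle_ineq[of "g (x $ 1)" "h (x $ 2)"] unfolding \<Delta>_def mem_Collect_eq by linarith
qed

text \<open>Attaining \<open>M\<close> inside the disc would make \<open>g\<close> constant by the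
  maximum principle, against its value at \<open>w\<close>. The strict bound is what a disc
  automorphism requires.\<close>

lemma norm_less_of_norm_le_on_disc:
  assumes "g holomorphic_on ball 0 1" "\<And>z. cmod z < 1 \<Longrightarrow> cmod (g z) \<le> M"
    and "cmod w < 1" "cmod (g w) < M" "cmod z < 1"
  shows "cmod (g z) < M"
proof (rule ccontr)
  assume "\<not> cmod (g z) < M"
  then have "cmod (g z) = M" using assms(2,5) by force
  then have "g constant_on ball 0 1"
    using assms by (intro maximum_modulus_principle[of g "ball 0 1" "ball 0 1" z]) auto
  then have "g z = g w" using assms by (auto simp: constant_on_def)
  then show False using \<open>cmod (g z) = M\<close> assms(4) by simp
qed

lemma constant_of_norm_le_on_disc:
  assumes "g holomorphic_on ball 0 1" "\<And>z. cmod z < 1 \<Longrightarrow> cmod (g z) \<le> cmod (g 0)" "cmod z < 1"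
  shows "g z = g 0"
proof -
  have "g constant_on ball 0 1"
    using assms by (intro maximum_modulus_principle[of g "ball 0 1" "ball 0 1" 0]) auto
  then show ?thesis using assms(3) by (auto simp: constant_on_def)
qed

text \<open>A disc automorphism moves the common value at the origin to \<open>0\<close>. After that the extension is
  the sum of the two functions, bounded by \<open>\<bar>x\<^sub>1\<bar> + \<bar>x\<^sub>2\<bar> < 1\<close> by the Schwarz lemma.\<close>

lemma diamond_extension_unit:
  fixes g h :: "complex \<Rightarrow> complex"
  assumes g: "g holomorphic_on ball 0 1" and h: "h holomorphic_on ball 0 1" and gh: "g 0 = h 0"
    and g1: "\<And>z. cmod z < 1 \<Longrightarrow> cmod (g z) < 1" and h1: "\<And>z. cmod z < 1 \<Longrightarrow> cmod (h z) < 1"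
  defines "\<Delta> \<equiv> {x::complex^2. cmod (x $ 1) + cmod (x $ 2) < 1}"
  shows "\<exists>F. holomorphic_several_on F \<Delta> \<and> (\<forall>x\<in>\<Delta>. cmod (F x) < 1) \<and>
           (\<forall>x\<in>\<Delta>. x $ 2 = 0 \<longrightarrow> F x = g (x $ 1)) \<and> (\<forall>x\<in>\<Delta>. x $ 1 = 0 \<longrightarrow> F x = h (x $ 2))"
proof -
  define a where "a = g 0"
  have a: "cmod a < 1" "cmod (-a) < 1" using g1[of 0] by (auto simp: a_def)
  \<comment> \<open>\<open>?\<phi>\<close> sends the common value \<open>a\<close> to 0, and
    \<open>?\<psi>\<close> is its inverse on the disc.\<close>
  let ?\<phi> = "Moebius_function 0 a" and ?\<psi> = "Moebius_function 0 (-a)"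
  have hol: "(\<lambda>z. ?\<phi> (k z)) holomorphic_on ball 0 1"
    if "k holomorphic_on ball 0 1" "\<And>z. cmod z < 1 \<Longrightarrow> cmod (k z) < 1" for k
  proof -
    have "k ` ball 0 1 \<subseteq> ball 0 1" using that(2) by auto
    from holomorphic_on_compose_gen[OF that(1) Moebius_function_holomorphic[OF a(1)] this]
    show ?thesis by (simp add: o_def)
  qed
  have inv: "?\<psi> (?\<phi> z) = z" if "cmod z < 1" for z
    using that a by (intro Moebius_function_compose) auto
  let ?u = "\<lambda>x::complex^2. ?\<phi> (g (x $ 1)) + ?\<phi> (h (x $ 2))"
  have 0: "?\<phi> (g 0) = 0" "?\<phi> (h 0) = 0"
    using gh by (simp_all add: a_def Moebius_function_eq_zero)
  have u: "holomorphic_several_on ?u \<Delta>" "\<And>x. x \<in> \<Delta> \<Longrightarrow> cmod (?u x) < 1"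
    using diamond_extension_of_centred[OF hol[OF g g1] hol[OF h h1] 0] g1 h1 a
    by (auto simp: \<Delta>_def Moebius_function_norm_lt_1)
  have "holomorphic_several_on (\<lambda>x. ?\<psi> (?u x)) \<Delta>"
    using u(2)
    by (intro holomorphic_several_on_compose[OF u(1) Moebius_function_holomorphic[OF a(2)] open_ball])
      auto
  moreover have "cmod (?\<psi> (?u x)) < 1" if "x \<in> \<Delta>" for x
    using u(2)[OF that] a by (intro Moebius_function_norm_lt_1) auto
  \<comment> \<open>On an axis one summand of \<open>?u\<close> is 0 and \<open>?\<psi>\<close>
    undoes \<open>?\<phi>\<close> on the other, which leaves \<open>g\<close> or
    \<open>h\<close>.\<close>
  ultimately show ?thesis
    using 0 inv g1 h1 by (intro exI[of _ "\<lambda>x. ?\<psi> (?u x)"]) (auto simp: \<Delta>_def)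
qed

text \<open>If the common value at 0 has modulus below \<open>M\<close>, both functions stay
  strictly below \<open>M\<close>, and dividing by \<open>M\<close> reduces to
  \<open>diamond_extension_unit\<close>. Otherwise both are constant and the constant extends
  them.\<close>

lemma diamond_extension:
  fixes g h :: "complex \<Rightarrow> complex"
  assumes g: "g holomorphic_on ball 0 1" and h: "h holomorphic_on ball 0 1" and gh: "g 0 = h 0"
    and gM: "\<And>z. cmod z < 1 \<Longrightarrow> cmod (g z) \<le> M" and hM: "\<And>z. cmod z < 1 \<Longrightarrow> cmod (h z) \<le> M"
  defines "\<Delta> \<equiv> {x::complex^2. cmod (x $ 1) + cmod (x $ 2) < 1}"
  shows "\<exists>F. holomorphic_several_on F \<Delta> \<and> (\<forall>x\<in>\<Delta>. cmod (F x) \<le> M) \<and>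
           (\<forall>x\<in>\<Delta>. x $ 2 = 0 \<longrightarrow> F x = g (x $ 1)) \<and> (\<forall>x\<in>\<Delta>. x $ 1 = 0 \<longrightarrow> F x = h (x $ 2))"
proof (cases "cmod (g 0) < M")
  case True
  then have M: "M > 0" using norm_ge_zero[of "g 0"] by linarith
  have less: "cmod (g z) < M" "cmod (h z) < M" if "cmod z < 1" for z
    using norm_less_of_norm_le_on_disc[OF g gM _ True that]
      norm_less_of_norm_le_on_disc[OF h hM _ _ that, of 0] True gh by simp_all
  have "(\<lambda>z. g z / M) holomorphic_on ball 0 1" "(\<lambda>z. h z / M) holomorphic_on ball 0 1"
    using g h M by (auto intro!: holomorphic_intros)
  moreover have "g 0 / M = h 0 / M" using gh by simp
  moreover have "cmod (g z / M) < 1" "cmod (h z / M) < 1" if "cmod z < 1" for z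
    using less[OF that] M by (simp_all add: norm_divide)
  ultimately obtain F where "holomorphic_several_on F \<Delta>" "\<forall>x\<in>\<Delta>. cmod (F x) < 1"
    "\<forall>x\<in>\<Delta>. x $ 2 = 0 \<longrightarrow> F x = g (x $ 1) / M" "\<forall>x\<in>\<Delta>. x $ 1 = 0 \<longrightarrow> F x = h (x $ 2) / M"
    unfolding \<Delta>_def using diamond_extension_unit[of "\<lambda>z. g z / M" "\<lambda>z. h z / M"] by blast
  then show ?thesis using M
    by (intro exI[of _ "\<lambda>x. M * F x"])
      (auto intro!: holomorphic_several_on_mult holomorphic_several_on_const simp: norm_mult less_imp_le)
next
  case False
  then have M: "cmod (g 0) = M" using gM[of 0] by auto
  \<comment> \<open>Here \<open>g\<close> and \<open>h\<close> both attain their bound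
    \<open>M\<close> at the interior point 0.\<close>
  have "g z = g 0" "h z = g 0" if "cmod z < 1" for z
    using constant_of_norm_le_on_disc[OF g _ that] constant_of_norm_le_on_disc[OF h _ that]
      gM hM gh M by auto
  then have "x \<in> \<Delta> \<Longrightarrow> x $ 2 = 0 \<longrightarrow> g 0 = g (x $ 1)" "x \<in> \<Delta> \<Longrightarrow> x $ 1 = 0 \<longrightarrow> g 0 = h (x $ 2)" for x
    unfolding \<Delta>_def by (metis (mono_tags) mem_Collect_eq norm_zero add_0 add.right_neutral)+
  then show ?thesis using M
    by (intro exI[of _ "\<lambda>x. g 0"]) (simp add: holomorphic_several_on_const)
qed

section \<open>Domains inside the diamond give norm preserving pairs\<close>

lemma analytic_set_in_crossed_discs:
  assumes "open G" "crossed_discs \<subseteq> G" "G \<subseteq> {x. cmod (x $ 1) + cmod (x $ 2) < 1}"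
  shows "analytic_set_in crossed_discs G"
proof -
  have eq: "crossed_discs = G \<inter> {x. x $ 1 * x $ 2 = 0}"
    using assms(2,3) by (auto simp: crossed_discs_eq_diamond)
  have "closed {x::complex^2. x $ 1 * x $ 2 = 0}"
    by (intro closed_Collect_eq continuous_intros)
  then have "closedin (top_of_set G) crossed_discs"
    unfolding eq by (rule closedin_closed_Int)
  moreover have "holomorphic_several_on (\<lambda>x::complex^2. x $ 1 * x $ 2) G"
    by (intro holomorphic_several_on_mult holomorphic_several_on_nth)
  ultimately show ?thesis
    unfolding analytic_set_in_def using assms(1) eq
    by (auto intro!: exI[of _ G] exI[of _ "{\<lambda>x::complex^2. x $ 1 * x $ 2}"])
qed

lemma np_pair_crossed_discs:
  assumes G: "domain_of_holomorphy G" and T: "crossed_discs \<subseteq> G"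
    and sub: "G \<subseteq> {x. cmod (x $ 1) + cmod (x $ 2) < 1}"
  shows "np_pair G crossed_discs"
proof -
  have "\<exists>F. holomorphic_several_on F G \<and> (\<forall>x\<in>crossed_discs. F x = f x) \<and>
      (SUP x\<in>G. ennreal (cmod (F x))) = (SUP x\<in>crossed_discs. ennreal (cmod (f x)))"
    if f: "holomorphic_on_subset f crossed_discs" and bdd: "bounded (f ` crossed_discs)" for f
  proof -
    \<comment> \<open>\<open>enn2real\<close> sends infinity to 0, so \<open>M\<close> represents
      the supremum only once boundedness of \<open>f\<close> shows that it is finite; this is
      \<open>SUP_M\<close>.\<close>
    define M where "M = enn2real (SUP x\<in>crossed_discs. ennreal (cmod (f x)))"
    obtain B where "\<And>x. x \<in> crossed_discs \<Longrightarrow> cmod (f x) \<le> B"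
      using bdd by (auto simp: bounded_iff)
    then have "(SUP x\<in>crossed_discs. ennreal (cmod (f x))) \<le> ennreal B"
      by (intro SUP_least ennreal_leI)
    then have SUP_M: "(SUP x\<in>crossed_discs. ennreal (cmod (f x))) = ennreal M"
      unfolding M_def by (metis ennreal_enn2real ennreal_less_top le_less_trans)
    have M: "cmod (f x) \<le> M" if "x \<in> crossed_discs" for x
    proof -
      have "ennreal (cmod (f x)) \<le> ennreal M"
        unfolding SUP_M[symmetric] using that by (rule SUP_upper)
      then show ?thesis by (simp add: M_def)
    qed
    let ?g = "\<lambda>z. f (z *s vector [1, 0])" and ?h = "\<lambda>z. f (z *s vector [0, 1])"
    have "?g holomorphic_on ball 0 1" "?h holomorphic_on ball 0 1"
      by (auto intro!: holomorphic_on_subset_slice[OF f] axis_in_crossed_discs)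
    then obtain F where F: "holomorphic_several_on F {x::complex^2. cmod (x $ 1) + cmod (x $ 2) < 1}"
      "\<And>x. cmod (x $ 1) + cmod (x $ 2) < 1 \<Longrightarrow> cmod (F x) \<le> M"
      "\<And>x. cmod (x $ 1) + cmod (x $ 2) < 1 \<Longrightarrow> x $ 2 = 0 \<Longrightarrow> F x = ?g (x $ 1)"
      "\<And>x. cmod (x $ 1) + cmod (x $ 2) < 1 \<Longrightarrow> x $ 1 = 0 \<Longrightarrow> F x = ?h (x $ 2)"
      using diamond_extension[of ?g ?h M] M[OF axis_in_crossed_discs(1)] M[OF axis_in_crossed_discs(2)]
      by auto
    have Ff: "F x = f x" if "x \<in> crossed_discs" for x
      using that F(3)[of x] F(4)[of x] by (auto simp: crossed_discs_eq)
    have "(SUP x\<in>G. ennreal (cmod (F x))) = ennreal M"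
    proof (rule antisym)
      show "(SUP x\<in>G. ennreal (cmod (F x))) \<le> ennreal M"
        using F(2) sub by (intro SUP_least ennreal_leI) auto
      \<comment> \<open>The supremum cannot drop, because \<open>F\<close> agrees with
        \<open>f\<close> on the crossed discs, which lie in \<open>G\<close>.\<close>
      have "(SUP x\<in>crossed_discs. ennreal (cmod (F x))) \<le> (SUP x\<in>G. ennreal (cmod (F x)))"
        using T by (rule SUP_subset_mono) simp
      then show "ennreal M \<le> (SUP x\<in>G. ennreal (cmod (F x)))"
        using Ff SUP_M by simp
    qed
    then show ?thesis
      using holomorphic_several_on_subset[OF F(1) sub] Ff SUP_M by auto
  qed
  moreover have "open G" using G by (simp add: domain_of_holomorphy_def)
  ultimately show ?thesis
    unfolding np_pair_def Cartan_pair_def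
    using G analytic_set_in_crossed_discs[OF _ T sub] by blast
qed

section \<open>Norm preserving pairs lie inside the diamond\<close>

text \<open>Extend \<open>x\<^sub>1 + c x\<^sub>2\<close> with a unimodular \<open>c\<close> chosen so that its modulus at \<open>p\<close> is
  \<open>\<bar>p\<^sub>1\<bar> + \<bar>p\<^sub>2\<bar>\<close>. The extension has the same differential at \<open>0\<close>, so the Cauchy inequality on the
  disc through \<open>p\<close> bounds this value by \<open>1\<close>.\<close>

lemma np_pair_crossed_discs_norm_le:
  assumes bal: "balanced G" and G: "open G" and T: "crossed_discs \<subseteq> G"
    and np: "np_pair G crossed_discs" and p: "p \<in> G"
  shows "cmod (p $ 1) + cmod (p $ 2) \<le> 1"
proof -
  obtain c where c: "cmod c = 1" and cp: "cmod (p $ 1 + c * p $ 2) = cmod (p $ 1) + cmod (p $ 2)"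
  proof -
    \<comment> \<open>The phase of \<open>z\<close>, with value 1 at 0 so that it is always
      unimodular and can be divided by.\<close>
    define s where "s = (\<lambda>z::complex. if z = 0 then 1 else sgn z)"
    have s: "cmod (s z) = 1" "z = s z * cmod z" for z
      by (auto simp: s_def norm_sgn) (auto simp: sgn_eq)
    \<comment> \<open>Multiplication by \<open>c\<close> turns \<open>p $ 2\<close> to the phase of
      \<open>p $ 1\<close>, which gives equality in the triangle inequality.\<close>
    define c where "c = s (p $ 1) / s (p $ 2)"
    have "s (p $ 2) \<noteq> 0" using s(1)[of "p $ 2"] by auto
    then have "c * p $ 2 = s (p $ 1) * cmod (p $ 2)"
      using s(2)[of "p $ 2"] by (simp add: c_def field_simps)
    then have "p $ 1 + c * p $ 2 = s (p $ 1) * of_real (cmod (p $ 1) + cmod (p $ 2))"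
      using s(2)[of "p $ 1"] by (simp add: algebra_simps)
    then have "cmod (p $ 1 + c * p $ 2) = cmod (p $ 1) + cmod (p $ 2)"
      by (simp only: norm_mult s(1) norm_of_real) simp
    moreover have "cmod c = 1" by (simp add: c_def norm_divide s(1))
    ultimately show thesis by (rule that[rotated])
  qed
  define f where "f = (\<lambda>x::complex^2. x $ 1 + c * x $ 2)"
  have "holomorphic_several_on f UNIV"
    unfolding f_def by (intro holomorphic_several_on_add holomorphic_several_on_mult
        holomorphic_several_on_nth holomorphic_several_on_const)
  then have "holomorphic_on_subset f crossed_discs"
    unfolding holomorphic_on_subset_def by blast
  moreover have f_le: "cmod (f x) \<le> 1" if "x \<in> crossed_discs" for x
    using that c by (auto simp: f_def crossed_discs_def norm_mult)
  moreover have "bounded (f ` crossed_discs)"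
    using f_le by (auto simp: bounded_iff)
  ultimately obtain F where F: "holomorphic_several_on F G" "\<And>x. x \<in> crossed_discs \<Longrightarrow> F x = f x"
    and SUP: "(SUP x\<in>G. ennreal (cmod (F x))) = (SUP x\<in>crossed_discs. ennreal (cmod (f x)))"
    using np unfolding np_pair_def by blast
  have F_le: "cmod (F x) \<le> 1" if "x \<in> G" for x
  proof -
    have "ennreal (cmod (F x)) \<le> (SUP x\<in>crossed_discs. ennreal (cmod (f x)))"
      unfolding SUP[symmetric] using that by (rule SUP_upper)
    also have "\<dots> \<le> 1"
      using f_le by (intro SUP_least) simp
    finally show ?thesis by simp
  qed
  have slice: "z *s p \<in> G" if "cmod z \<le> 1" for z
    using bal p that by (simp add: balanced_def)
  have "0 \<in> G" using slice[of 0] by simp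
  then obtain D where D: "(F has_derivative D) (at 0)" "\<And>c v. D (c *s v) = c * D v"
    using F(1) unfolding holomorphic_several_on_def by metis
  \<comment> \<open>Along such a line \<open>F\<close> equals the linear form \<open>f\<close>, so
    the derivative at 0 is \<open>f v\<close>. Only multiples with |z| < 1 are required to lie in
    the crossed discs, because the lemma is applied to the unit vectors, which are not in
    them.\<close>
  have D_axis: "D v = f v" if "\<And>z. cmod z < 1 \<Longrightarrow> z *s v \<in> crossed_discs" for v
  proof -
    have "((\<lambda>z. F (z *s v)) has_field_derivative D v) (at 0)"
      using D by (intro has_field_derivative_slice) auto
    moreover have "((\<lambda>z. F (z *s v)) has_field_derivative f v) (at 0)"
    proof (rule has_field_derivative_transform_within_open)
      show "((\<lambda>z. z * f v) has_field_derivative f v) (at 0)"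
        by (auto intro!: derivative_eq_intros)
      show "z * f v = F (z *s v)" if "z \<in> ball 0 1" for z
        using that F(2) \<open>\<And>z. cmod z < 1 \<Longrightarrow> z *s v \<in> crossed_discs\<close>
        by (simp add: f_def algebra_simps)
    qed auto
    ultimately show ?thesis by (rule DERIV_unique)
  qed
  have "D p = f p"
  proof -
    have "p = p $ 1 *s vector [1, 0] + p $ 2 *s vector [0, 1]"
      by (simp add: vec_eq_iff forall_2)
    then have "D p = D (p $ 1 *s vector [1, 0] + p $ 2 *s vector [0, 1])"
      by simp
    also have "\<dots> = p $ 1 * D (vector [1, 0]) + p $ 2 * D (vector [0, 1])"
      using D by (simp add: linear_add[OF has_derivative_linear])
    also have "\<dots> = p $ 1 * f (vector [1, 0]) + p $ 2 * f (vector [0, 1])"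
      by (simp only: D_axis axis_in_crossed_discs)
    finally show ?thesis by (simp add: f_def)
  qed
  then have der: "deriv (\<lambda>z. F (z *s p)) 0 = f p"
    using has_field_derivative_slice[of F D 0 p] D by (auto intro!: DERIV_imp_deriv)
  have diff: "(\<lambda>z. F (z *s p)) field_differentiable at z" if "cmod z \<le> 1" for z
  proof -
    obtain E where "(F has_derivative E) (at (z *s p))" "\<And>c v. E (c *s v) = c * E v"
      using F(1) slice[OF \<open>cmod z \<le> 1\<close>] unfolding holomorphic_several_on_def by metis
    from has_field_derivative_slice[OF this] show ?thesis
      by (auto simp: field_differentiable_def)
  qed
  \<comment> \<open>The first-order Cauchy estimate on the unit disc with bound 1. It uses
    \<open>F\<close> up to the boundary circle, which balancedness keeps in
    \<open>G\<close>.\<close>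
  have "cmod ((deriv ^^ 1) (\<lambda>z. F (z *s p)) 0) \<le> fact 1 * 1 / 1 ^ 1"
  proof (rule Cauchy_inequality)
    show "(\<lambda>z. F (z *s p)) holomorphic_on ball 0 1"
      using diff by (auto simp: holomorphic_on_def intro: field_differentiable_at_within)
    show "continuous_on (cball 0 1) (\<lambda>z. F (z *s p))"
      using diff by (auto intro!: continuous_at_imp_continuous_on field_differentiable_imp_continuous_at)
    show "cmod (F (z *s p)) \<le> 1" if "cmod (0 - z) = 1" for z
      using that F_le slice by simp
  qed auto
  then show ?thesis
    using der cp by (simp add: f_def)
qed

text \<open>Used to sharpen the weak inequality: applied to r p with r > 1, it yields |p1| + |p2| <=
  1/r < 1.\<close>

lemma open_dilate:
  fixes G :: "(complex^'n) set"
  assumes "open G" "p \<in> G"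
  obtains r :: real where "r > 1" "of_real r *s p \<in> G"
proof -
  have "continuous_on UNIV (\<lambda>r::real. of_real r *s p)"
    unfolding vector_scalar_mult_def by (intro continuous_intros)
  then have "open ((\<lambda>r::real. of_real r *s p) -` G)"
    using assms(1) by (simp add: continuous_on_open_vimage)
  moreover have "1 \<in> (\<lambda>r::real. of_real r *s p) -` G"
    using assms(2) by simp
  ultimately obtain e where e: "e > 0" "ball 1 e \<subseteq> (\<lambda>r::real. of_real r *s p) -` G"
    unfolding open_contains_ball by blast
  then have "1 + e / 2 \<in> (\<lambda>r::real. of_real r *s p) -` G"
    by (intro subsetD[OF e(2)]) (auto simp: dist_real_def)
  with e(1) show thesis by (intro that[of "1 + e / 2"]) auto
qed

theorem theorem5p5:
  fixes G :: "(complex ^ 2) set"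
  assumes "balanced G"
    and "domain_of_holomorphy G"
    and "crossed_discs \<subseteq> G"
  shows "np_pair G crossed_discs \<longleftrightarrow> G \<subseteq> {x. cmod (x $ 1) + cmod (x $ 2) < 1}"
proof
  assume "G \<subseteq> {x. cmod (x $ 1) + cmod (x $ 2) < 1}"
  then show "np_pair G crossed_discs"
    by (rule np_pair_crossed_discs[OF assms(2,3)])
next
  assume np: "np_pair G crossed_discs"
  have G: "open G" using assms(2) by (simp add: domain_of_holomorphy_def)
  show "G \<subseteq> {x. cmod (x $ 1) + cmod (x $ 2) < 1}"
  proof
    fix p assume "p \<in> G"
    then obtain r where r: "r > 1" "of_real r *s p \<in> G"
      using open_dilate[OF G] by blast
    have "r * (cmod (p $ 1) + cmod (p $ 2)) \<le> 1"
      using np_pair_crossed_discs_norm_le[OF assms(1) G assms(3) np r(2)] r(1)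
      by (simp add: norm_mult algebra_simps)
    then have "cmod (p $ 1) + cmod (p $ 2) \<le> 1 / r"
      using r(1) by (simp add: field_simps)
    also have "\<dots> < 1" using r(1) by simp
    finally show "p \<in> {x. cmod (x $ 1) + cmod (x $ 2) < 1}" by simp
  qed
qed

end
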